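(* Let $m\geqslant 2$ be an integer and let $G$ be a finite group with $|G|\geqslant 2$. Then the diagonal graph $\Gamma_D(G,m)$ is distance-regular if and only if either $m=2$ or $|G|=2$.
   Context: Diagonal graph: for a group $G$ and an integer $m\geqslant 1$, let $\Omega=G^m$. For $1\leqslant i\leqslant m$, let $Q_i$ be the partition of $\Omega$ in which $(g_1,\ldots,g_m)$ and $(h_1,\ldots,h_m)$ are in the same part if and only if $g_j=h_j$ for all $j\neq i$. Let $Q_0$ be the partition in which $(g_1,\ldots,g_m)$ and $(h_1,\ldots,h_m)$ are in the same part if and only if there is $x\in G$ with $h_i=xg_i$ for all $i$. The diagonal graph $\Gamma_D(G,m)$ is the simple graph with vertex set $\Omega$ in which two distinct vertices are adjacent if and only if they lie in the same part of at least one of $Q_0,Q_1,\ldots,Q_m$. A finite connected graph $\Gamma$ is distance-regular if for every integer $d\geqslant 0$ and all vertices $u,v$ at distance $d$, the numbers of neighbours of $v$ at distance $d-1$, $d$ and $d+1$ from $u$ depend only on $d$ (and not on the choice of $u,v$). Strongly regular connected graphs and complete graphs are included as distance-regular. *)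

theory Defs
  imports "HOL-Algebra.Group" "HOL-Library.Disjoint_Sets" "Graph_Theory.Graph_Theory"
begin

text \<open>Tuples in \<open>G\<^sup>m\<close> are extensional functions on the index set \<open>{1..m}\<close>.\<close>

definition diag_verts :: "('a, 'b) monoid_scheme \<Rightarrow> nat \<Rightarrow> (nat \<Rightarrow> 'a) set" where
  "diag_verts G m = ({1..m} \<rightarrow>\<^sub>E carrier G)"

text \<open>The relation of lying in the same part of \<open>Q\<^sub>i\<close>.  The index \<open>i = 0\<close> encodes
  the diagonal partition \<open>Q\<^sub>0\<close> (a common left factor); \<open>1 \<le> i \<le> m\<close> are the coordinate partitions.\<close>

definition diag_rel :: "('a, 'b) monoid_scheme \<Rightarrow> nat \<Rightarrow> nat \<Rightarrow> ((nat \<Rightarrow> 'a) \<times> (nat \<Rightarrow> 'a)) set" where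
  "diag_rel G m i =
    {(g, h). g \<in> diag_verts G m \<and> h \<in> diag_verts G m \<and>
      (if i = 0 then \<exists>x\<in>carrier G. \<forall>j\<in>{1..m}. h j = x \<otimes>\<^bsub>G\<^esub> g j
       else \<forall>j\<in>{1..m}. j \<noteq> i \<longrightarrow> g j = h j)}"

definition diag_partition :: "('a, 'b) monoid_scheme \<Rightarrow> nat \<Rightarrow> nat \<Rightarrow> (nat \<Rightarrow> 'a) set set" where
  "diag_partition G m i = diag_verts G m // diag_rel G m i"

definition diagonal_graph :: "('a, 'b) monoid_scheme \<Rightarrow> nat \<Rightarrow> (nat \<Rightarrow> 'a) pair_pre_digraph" where
  "diagonal_graph G m =
    \<lparr> pverts = diag_verts G m,
      parcs = {(g, h). g \<in> diag_verts G m \<and> h \<in> diag_verts G m \<and> g \<noteq> h \<and>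
                 (\<exists>i\<in>{0..m}. \<exists>P\<in>diag_partition G m i. g \<in> P \<and> h \<in> P)} \<rparr>"

text \<open>The graph distance is the minimal cost of a walk for unit arc weights;
  it is \<open>\<infinity>\<close> between different components.\<close>

definition graph_dist :: "('a, 'b) pre_digraph \<Rightarrow> 'a \<Rightarrow> 'a \<Rightarrow> ereal" where
  "graph_dist X u v = wf_digraph.\<mu> X (\<lambda>_. 1) u v"

text \<open>The locale predicate \<^const>\<open>graph\<close> provides finiteness and simplicity.  The value
  \<open>real d - 1\<close> is computed in the reals, so that for \<open>d = 0\<close> the set counted
  by \<open>c\<close> is empty rather than involving a truncated subtraction.\<close>

definition distance_regular :: "('a, 'b) pre_digraph \<Rightarrow> bool" where
  "distance_regular X \<longleftrightarrow>
    graph X \<and> Digraph_Component.connected X \<and>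
    (\<forall>d::nat. \<exists>c a b. \<forall>u\<in>verts X. \<forall>v\<in>verts X. graph_dist X u v = ereal (real d) \<longrightarrow>
       card {w. v \<rightarrow>\<^bsub>X\<^esub> w \<and> graph_dist X u w = ereal (real d - 1)} = c \<and>
       card {w. v \<rightarrow>\<^bsub>X\<^esub> w \<and> graph_dist X u w = ereal (real d)} = a \<and>
       card {w. v \<rightarrow>\<^bsub>X\<^esub> w \<and> graph_dist X u w = ereal (real d + 1)} = b)"

lemma equiv_diag_rel:
  assumes "group G"
  shows "equiv (diag_verts G m) (diag_rel G m i)"
proof -
  interpret group G by fact
  have in_carrier: "g j \<in> carrier G" if "g \<in> diag_verts G m" "j \<in> {1..m}" for g j
    using that unfolding diag_verts_def by (rule PiE_mem)
  show ?thesis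
  proof (rule equivI)
    show "diag_rel G m i \<subseteq> diag_verts G m \<times> diag_verts G m"
      by (auto simp: diag_rel_def)
    show "refl_on (diag_verts G m) (diag_rel G m i)"
      by (auto simp: refl_on_def diag_rel_def in_carrier intro!: bexI[of _ "\<one>\<^bsub>G\<^esub>"])
    show "sym (diag_rel G m i)"
    proof (rule symI)
      fix g h assume gh: "(g, h) \<in> diag_rel G m i"
      show "(h, g) \<in> diag_rel G m i"
      proof (cases "i = 0")
        case True
        then obtain x where x: "x \<in> carrier G" "\<forall>j\<in>{1..m}. h j = x \<otimes>\<^bsub>G\<^esub> g j"
          using gh by (auto simp: diag_rel_def)
        have "\<forall>j\<in>{1..m}. g j = inv\<^bsub>G\<^esub> x \<otimes>\<^bsub>G\<^esub> h j"
          using x gh by (auto simp: diag_rel_def in_carrier m_assoc[symmetric])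
        then show ?thesis using True gh x(1) by (auto simp: diag_rel_def)
      qed (use gh in \<open>auto simp: diag_rel_def\<close>)
    qed
    show "trans (diag_rel G m i)"
    proof (rule transI)
      fix g h k assume gh: "(g, h) \<in> diag_rel G m i" and hk: "(h, k) \<in> diag_rel G m i"
      show "(g, k) \<in> diag_rel G m i"
      proof (cases "i = 0")
        case True
        then obtain x y where x: "x \<in> carrier G" "\<forall>j\<in>{1..m}. h j = x \<otimes>\<^bsub>G\<^esub> g j"
          and y: "y \<in> carrier G" "\<forall>j\<in>{1..m}. k j = y \<otimes>\<^bsub>G\<^esub> h j"
          using gh hk by (auto simp: diag_rel_def)
        have "\<forall>j\<in>{1..m}. k j = (y \<otimes>\<^bsub>G\<^esub> x) \<otimes>\<^bsub>G\<^esub> g j"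
          using x y gh by (auto simp: diag_rel_def in_carrier m_assoc)
        then show ?thesis using True gh hk x(1) y(1) by (auto simp: diag_rel_def)
      qed (use gh hk in \<open>auto simp: diag_rel_def\<close>)
    qed
  qed
qed

lemma partition_on_diag_partition:
  assumes "group G"
  shows "partition_on (diag_verts G m) (diag_partition G m i)"
  unfolding diag_partition_def by (rule partition_on_quotient[OF equiv_diag_rel[OF assms]])

lemma same_part_iff:
  assumes "group G"
  shows "(\<exists>P\<in>diag_partition G m i. g \<in> P \<and> h \<in> P) \<longleftrightarrow> (g, h) \<in> diag_rel G m i"
proof -
  note eq = equiv_diag_rel[OF assms, of m i]
  show ?thesis
  proof
    assume "\<exists>P\<in>diag_partition G m i. g \<in> P \<and> h \<in> P"
    then show "(g, h) \<in> diag_rel G m i"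
      using quotient_eq_iff[OF eq] unfolding diag_partition_def by blast
  next
    assume gh: "(g, h) \<in> diag_rel G m i"
    then have "g \<in> diag_verts G m" by (auto simp: diag_rel_def)
    then have "diag_rel G m i `` {g} \<in> diag_partition G m i"
      and "g \<in> diag_rel G m i `` {g}"
      using equiv_class_self[OF eq] by (auto simp: diag_partition_def intro: quotientI)
    then show "\<exists>P\<in>diag_partition G m i. g \<in> P \<and> h \<in> P" using gh by blast
  qed
qed

lemma graph_diagonal_graph:
  assumes "finite (carrier G)"
  shows "graph (with_proj (diagonal_graph G m))"
proof -
  have fin: "finite (diag_verts G m)"
    unfolding diag_verts_def using assms by (intro finite_PiE) auto
  have "pair_graph (diagonal_graph G m)"
  proof
    show "finite (parcs (diagonal_graph G m))"
      by (rule finite_subset[of _ "diag_verts G m \<times> diag_verts G m"])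
        (use fin in \<open>auto simp: diagonal_graph_def\<close>)
    show "symmetric (with_proj (diagonal_graph G m))"
      unfolding symmetric_def by (auto simp: diagonal_graph_def sym_def)
  qed (use fin in \<open>auto simp: diagonal_graph_def\<close>)
  then interpret pair_graph "diagonal_graph G m" .
  show ?thesis by unfold_locales
qed

end

theory Submission
  imports Defs "HOL-Combinatorics.Permutations"
begin

text \<open>
  A pair of vertices \<open>u, v\<close> gives the tuple \<open>(1, v\<^sub>1 u\<^sub>1\<^sup>-\<^sup>1, \<dots>, v\<^sub>m u\<^sub>m\<^sup>-\<^sup>1)\<close> of length \<open>n = m + 1\<close>.
  Up to a common left factor, the neighbours of \<open>v\<close> are obtained by changing one of its \<open>n\<close>
  entries, the change of the entry \<open>0\<close> being the move in \<open>Q\<^sub>0\<close>.  Hence the distance of \<open>u\<close> and \<open>v\<close>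
  is the Hamming distance of this tuple to the set of constant tuples, and the number of
  neighbours of \<open>v\<close> at a given distance from \<open>u\<close> depends only on the multiset of multiplicities
  of the entries.  If \<open>|G| = 2\<close> or \<open>n = 3\<close>, the largest multiplicity determines this multiset.
  Otherwise put \<open>k = \<lfloor>n/2\<rfloor> \<ge> 2\<close> and compare a tuple with multiplicities \<open>{n - k, k}\<close> with one with
  multiplicities \<open>{n - k, k - 1, 1}\<close>.  Both have distance \<open>k\<close> to the constants, but the first has more
  changes of one entry after which some value occurs in a strict majority of the entries,
  that is, after which the distance is less than \<open>n/2\<close>.
\<close>

section \<open>Hamming distance to the constant tuples\<close>

text \<open>This is the Hamming distance on \<open>I\<close> from \<open>f\<close> to the constant
  tuple with value \<open>x\<close>.\<close>

definition dev :: "'i set \<Rightarrow> ('i \<Rightarrow> 'a) \<Rightarrow> 'a \<Rightarrow> nat" where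
  "dev I f x = card {i \<in> I. f i \<noteq> x}"

definition const_dist :: "'i set \<Rightarrow> 'a set \<Rightarrow> ('i \<Rightarrow> 'a) \<Rightarrow> nat" where
  "const_dist I A f = Min (dev I f ` A)"

text \<open>A pair stands for the tuple \<open>f(i := a)\<close>; because of
  \<open>a \<noteq> f i\<close>, different pairs give different tuples.\<close>

definition moves :: "'i set \<Rightarrow> 'a set \<Rightarrow> ('i \<Rightarrow> 'a) \<Rightarrow> ('i \<times> 'a) set" where
  "moves I A f = {(i, a). i \<in> I \<and> a \<in> A \<and> a \<noteq> f i}"

definition moves_to :: "'i set \<Rightarrow> 'a set \<Rightarrow> ('i \<Rightarrow> 'a) \<Rightarrow> nat \<Rightarrow> ('i \<times> 'a) set" where
  "moves_to I A f e = {(i, a) \<in> moves I A f. const_dist I A (f(i := a)) = e}"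

text \<open>Only position \<open>i\<close> changes its contribution. The old and the new
  contribution are added on opposite sides, which avoids truncated subtraction.\<close>

lemma dev_upd:
  assumes "finite I" "i \<in> I"
  shows "dev I (f(i := a)) x + of_bool (f i \<noteq> x) = dev I f x + of_bool (a \<noteq> x)"
proof -
  have *: "dev I g x = card {j \<in> I - {i}. g j \<noteq> x} + of_bool (g i \<noteq> x)" for g
  proof -
    have "{j \<in> I. g j \<noteq> x} = {j \<in> I - {i}. g j \<noteq> x} \<union> (if g i \<noteq> x then {i} else {})"
      using assms by auto
    then show ?thesis
      unfolding dev_def using assms by (auto simp: card_insert_if)
  qed
  have "{j \<in> I - {i}. (f(i := a)) j \<noteq> x} = {j \<in> I - {i}. f j \<noteq> x}"
    by auto
  then show ?thesis
    unfolding *[of f] *[of "f(i := a)"] by simp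
qed

lemma dev_eq_card_diff:
  assumes "finite I"
  shows "dev I f x = card I - card {i \<in> I. f i = x}"
proof -
  have "{i \<in> I. f i \<noteq> x} = I - {i \<in> I. f i = x}" by auto
  then show ?thesis
    unfolding dev_def using assms by (simp add: card_Diff_subset)
qed

lemma card_fiber_add_dev:
  assumes "finite I"
  shows "card {i \<in> I. f i = x} + dev I f x = card I"
  using dev_eq_card_diff[OF assms, of f x] card_mono[OF assms, of "{i \<in> I. f i = x}"] by auto

lemma dev_reindex:
  assumes "bij_betw \<sigma> I J" "inj_on \<pi> A" "f \<in> I \<rightarrow> A" "x \<in> A" "\<And>i. i \<in> I \<Longrightarrow> g (\<sigma> i) = \<pi> (f i)"
  shows "dev J g (\<pi> x) = dev I f x"
proof -
  have "{j \<in> J. g j \<noteq> \<pi> x} = \<sigma> ` {i \<in> I. f i \<noteq> x}"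
    using assms by (auto simp: bij_betw_def inj_on_def Pi_iff)
  moreover have "inj_on \<sigma> {i \<in> I. f i \<noteq> x}"
    using assms(1) by (auto simp: bij_betw_def inj_on_def)
  ultimately show ?thesis
    unfolding dev_def by (simp add: card_image)
qed

context
  fixes I :: "'i set" and A :: "'a set"
  assumes fin_I: "finite I" and fin_A: "finite A" and A_ne: "A \<noteq> {}"
begin

lemma const_dist_le: "x \<in> A \<Longrightarrow> const_dist I A f \<le> dev I f x"
  unfolding const_dist_def using fin_A by simp

lemma const_dist_attained:
  obtains x where "x \<in> A" "const_dist I A f = dev I f x"
proof -
  have "const_dist I A f \<in> dev I f ` A"
    unfolding const_dist_def using fin_A A_ne by (intro Min_in) auto
  then show ?thesis using that by auto
qed

lemma const_dist_eqI:
  assumes "x \<in> A" "dev I f x = d" "\<And>y. y \<in> A \<Longrightarrow> d \<le> dev I f y"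
  shows "const_dist I A f = d"
  using assms by (metis const_dist_attained const_dist_le le_antisym)

text \<open>For \<open>n = card I\<close>, the right-hand side says that some value of
  \<open>A\<close> fills a strict majority of the positions.\<close>

lemma const_dist_less_iff: "2 * const_dist I A f < n \<longleftrightarrow> (\<exists>x\<in>A. 2 * dev I f x < n)"
proof
  assume "2 * const_dist I A f < n"
  then show "\<exists>x\<in>A. 2 * dev I f x < n" by (metis const_dist_attained)
next
  assume "\<exists>x\<in>A. 2 * dev I f x < n"
  then show "2 * const_dist I A f < n"
    using const_dist_le by (meson le_less_trans mult_le_mono2)
qed

lemma const_dist_upd_le:
  assumes "i \<in> I"
  shows "const_dist I A (f(i := a)) \<le> Suc (const_dist I A f)"
proof -
  obtain x where x: "x \<in> A" "const_dist I A f = dev I f x"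
    by (rule const_dist_attained)
  have "dev I (f(i := a)) x \<le> Suc (dev I f x)"
    using dev_upd[OF fin_I assms, of f a x] by (auto simp: of_bool_def split: if_splits)
  then show ?thesis using const_dist_le[OF x(1), of "f(i := a)"] x(2) by simp
qed

text \<open>Restoring the old entry is again a change of one entry.\<close>

lemma const_dist_le_upd:
  assumes "i \<in> I"
  shows "const_dist I A f \<le> Suc (const_dist I A (f(i := a)))"
  using const_dist_upd_le[OF assms, of "f(i := a)" "f i"] by simp

text \<open>Overwriting a wrong entry by the value of a nearest constant tuple lowers the deviation
  from that value by one, and no single change can lower the distance further.\<close>

lemma const_dist_decrease:
  assumes "0 < const_dist I A f"
  obtains i a where "(i, a) \<in> moves I A f" "Suc (const_dist I A (f(i := a))) = const_dist I A f"
proof -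
  obtain x where x: "x \<in> A" "const_dist I A f = dev I f x"
    by (rule const_dist_attained)
  then have "{i \<in> I. f i \<noteq> x} \<noteq> {}"
    using assms unfolding dev_def by (auto simp: card_gt_0_iff)
  then obtain i where i: "i \<in> I" "f i \<noteq> x" by auto
  have "Suc (dev I (f(i := x)) x) = dev I f x"
    using dev_upd[OF fin_I i(1), of f x x] i by simp
  then have "Suc (const_dist I A (f(i := x))) \<le> const_dist I A f"
    using const_dist_le[OF x(1), of "f(i := x)"] x(2) by simp
  then have "Suc (const_dist I A (f(i := x))) = const_dist I A f"
    using const_dist_le_upd[OF i(1), of f x] by simp
  with i x that show ?thesis by (auto simp: moves_def)
qed

lemma const_dist_eq_0_iff:
  "const_dist I A f = 0 \<longleftrightarrow> (\<exists>x\<in>A. \<forall>i\<in>I. f i = x)"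
proof -
  have "dev I f x = 0 \<longleftrightarrow> (\<forall>i\<in>I. f i = x)" for x
    unfolding dev_def using fin_I by auto
  then show ?thesis
    by (metis const_dist_attained const_dist_le le_zero_eq)
qed

section \<open>Invariance under relabelling of positions and values\<close>

text \<open>Relabelling only permutes the deviations over which the minimum is taken. With
  identities for \<open>\<sigma>\<close> and \<open>\<pi>\<close> this also says that entries
  outside \<open>I\<close> do not matter.\<close>

lemma const_dist_reindex:
  assumes \<sigma>: "bij_betw \<sigma> I I" and \<pi>: "bij_betw \<pi> A A" and f: "f \<in> I \<rightarrow> A"
    and g: "\<And>i. i \<in> I \<Longrightarrow> g (\<sigma> i) = \<pi> (f i)"
  shows "const_dist I A g = const_dist I A f"
proof -
  have "inj_on \<pi> A" using \<pi> by (simp add: bij_betw_def)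
  then have "(\<lambda>x. dev I g (\<pi> x)) ` A = dev I f ` A"
    by (intro image_cong refl dev_reindex[where I = I and \<sigma> = \<sigma> and A = A] \<sigma> f g)
  moreover have "(\<lambda>x. dev I g (\<pi> x)) ` A = dev I g ` A"
    using \<pi> by (metis bij_betw_imp_surj_on image_image)
  ultimately show ?thesis unfolding const_dist_def by simp
qed

text \<open>The tuple \<open>g(\<sigma> i := \<pi> a)\<close> is the relabelling of
  \<open>f(i := a)\<close>, so \<open>map_prod \<sigma> \<pi>\<close> is a bijection between the
  moves that preserves the distance reached.\<close>

lemma card_moves_to_reindex:
  assumes \<sigma>: "bij_betw \<sigma> I I" and \<pi>: "bij_betw \<pi> A A" and f: "f \<in> I \<rightarrow> A"
    and g: "\<And>i. i \<in> I \<Longrightarrow> g (\<sigma> i) = \<pi> (f i)"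
  shows "card (moves_to I A g e) = card (moves_to I A f e)"
proof -
  have inj: "inj_on \<sigma> I" "inj_on \<pi> A" and im: "\<sigma> ` I = I" "\<pi> ` A = A"
    using \<sigma> \<pi> by (auto simp: bij_betw_def)
  have cd: "const_dist I A (g(\<sigma> i := \<pi> a)) = const_dist I A (f(i := a))" if "i \<in> I" "a \<in> A" for i a
  proof (rule const_dist_reindex[OF \<sigma> \<pi>])
    show "f(i := a) \<in> I \<rightarrow> A" using f that by auto
    show "(g(\<sigma> i := \<pi> a)) (\<sigma> j) = \<pi> ((f(i := a)) j)" if "j \<in> I" for j
      using that \<open>i \<in> I\<close> g inj by (auto simp: inj_on_def)
  qed
  have ne: "\<pi> a \<noteq> g (\<sigma> i) \<longleftrightarrow> a \<noteq> f i" if "i \<in> I" "a \<in> A" for i a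
    using that g f inj by (auto simp: inj_on_def Pi_iff)
  have "moves_to I A g e = map_prod \<sigma> \<pi> ` moves_to I A f e"
  proof (intro equalityI subsetI)
    fix p assume p: "p \<in> moves_to I A g e"
    then have "fst p \<in> \<sigma> ` I" "snd p \<in> \<pi> ` A"
      using im by (auto simp: moves_to_def moves_def)
    then obtain i a where ia: "i \<in> I" "a \<in> A" "p = (\<sigma> i, \<pi> a)" by (metis imageE prod.collapse)
    then have "(i, a) \<in> moves_to I A f e"
      using p cd ne by (auto simp: moves_to_def moves_def)
    then show "p \<in> map_prod \<sigma> \<pi> ` moves_to I A f e" using ia by (auto simp: image_iff intro!: bexI[of _ "(i, a)"])
  next
    fix p assume "p \<in> map_prod \<sigma> \<pi> ` moves_to I A f e"
    then obtain i a where ia: "(i, a) \<in> moves_to I A f e" "p = (\<sigma> i, \<pi> a)" by auto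
    then show "p \<in> moves_to I A g e"
      using cd ne im by (auto simp: moves_to_def moves_def)
  qed
  moreover have "inj_on (map_prod \<sigma> \<pi>) (moves_to I A f e)"
    using map_prod_inj_on[OF inj] by (rule inj_on_subset) (auto simp: moves_to_def moves_def)
  ultimately show ?thesis by (simp add: card_image)
qed

text \<open>Equal multisets of multiplicities yield a permutation \<open>\<pi>\<close> of the values
  that matches fibre sizes. Then \<open>\<pi>\<close> after \<open>f\<close> takes every value as
  often as \<open>g\<close>, so a permutation \<open>\<sigma>\<close> of the positions matches the
  tuples themselves.\<close>

lemma card_moves_to_eq_if_fiber_sizes:
  assumes f: "f \<in> I \<rightarrow> A" and g: "g \<in> I \<rightarrow> A"
    and sizes: "image_mset (\<lambda>x. card {i \<in> I. f i = x}) (mset_set A) =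
      image_mset (\<lambda>x. card {i \<in> I. g i = x}) (mset_set A)"
  shows "card (moves_to I A g e) = card (moves_to I A f e)"
proof -
  obtain \<pi> where \<pi>: "\<pi> permutes A" "\<forall>x\<in>A. card {i \<in> I. f i = x} = card {i \<in> I. g i = \<pi> x}"
    using image_mset_eq_implies_permutes[OF fin_A sizes] by blast
  have inj: "inj \<pi>" using \<pi>(1) by (rule permutes_inj)
  have "image_mset (\<lambda>i. \<pi> (f i)) (mset_set I) = image_mset g (mset_set I)"
  proof (rule multiset_eqI)
    fix y
    have cnt: "count (image_mset h (mset_set I)) y = card {i \<in> I. h i = y}" for h :: "'i \<Rightarrow> 'a"
      using fin_I by (simp add: count_image_mset_eq_card_vimage)
    have "card {i \<in> I. \<pi> (f i) = y} = card {i \<in> I. g i = y}"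
    proof (cases "y \<in> A")
      case True
      then obtain x where x: "x \<in> A" "y = \<pi> x" using \<pi>(1) by (metis permutes_image imageE)
      then have "{i \<in> I. \<pi> (f i) = y} = {i \<in> I. f i = x}" using inj by (auto dest: injD)
      then show ?thesis using \<pi>(2) x by simp
    next
      case False
      then have "{i \<in> I. \<pi> (f i) = y} = {}" "{i \<in> I. g i = y} = {}"
        using f g \<pi>(1) by (auto simp: Pi_iff permutes_in_image)
      then show ?thesis by (simp only:)
    qed
    then show "count (image_mset (\<lambda>i. \<pi> (f i)) (mset_set I)) y = count (image_mset g (mset_set I)) y"
      unfolding cnt .
  qed
  from image_mset_eq_implies_permutes[OF fin_I this]
  obtain \<sigma> where \<sigma>: "\<sigma> permutes I" "\<forall>i\<in>I. \<pi> (f i) = g (\<sigma> i)" by blast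
  show ?thesis
    by (rule card_moves_to_reindex[OF permutes_imp_bij[OF \<sigma>(1)] permutes_imp_bij[OF \<pi>(1)] f])
      (use \<sigma>(2) in auto)
qed

end

section \<open>Multiplicities in the case of two values or three positions\<close>

lemma image_mset_01:
  fixes c :: "'a \<Rightarrow> nat"
  assumes "finite A" "\<And>x. x \<in> A \<Longrightarrow> c x \<le> 1"
  shows "image_mset c (mset_set A) = replicate_mset (sum c A) 1 + replicate_mset (card A - sum c A) 0"
proof -
  \<comment> \<open>The bound \<open>sum c A \<le> card A\<close> is carried through the induction
    so that \<open>card A - sum c A\<close> grows by one when an element of value 0 is
    inserted.\<close>
  have "image_mset c (mset_set A) = replicate_mset (sum c A) 1 + replicate_mset (card A - sum c A) 0 \<and> sum c A \<le> card A"
    using assms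
  proof (induction rule: finite_induct)
    case (insert a A)
    have "c a = 0 \<or> c a = 1" using insert.prems[of a] by auto
    with insert show ?case by (auto simp: Suc_diff_le)
  qed simp
  then show ?thesis ..
qed

text \<open>A nearest value \<open>x\<close> has multiplicity \<open>card I - D\<close>, and the
  other multiplicities sum to \<open>D\<close>. With two values there is just one other; with three
  positions each other one is 0 or 1, so their sum determines them.\<close>

lemma fiber_sizes_cong:
  assumes fin: "finite I" "finite A" "A \<noteq> {}"
    and f: "f \<in> I \<rightarrow> A" and g: "g \<in> I \<rightarrow> A"
    and d: "const_dist I A f = const_dist I A g"
    and small: "card A = 2 \<or> card I = 3"
  shows "image_mset (\<lambda>x. card {i \<in> I. f i = x}) (mset_set A) =
      image_mset (\<lambda>x. card {i \<in> I. g i = x}) (mset_set A)"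
proof -
  define D where "D = const_dist I A f"
  \<comment> \<open>the multiplicities other than the largest one, which is \<open>card I - D\<close>\<close>
  define rest where "rest = (if card A = 2 then {#D#} else replicate_mset D 1 + replicate_mset (card A - 1 - D) 0)"
  have *: "image_mset (\<lambda>x. card {i \<in> I. h i = x}) (mset_set A) = add_mset (card I - D) rest"
    if h: "h \<in> I \<rightarrow> A" and hD: "const_dist I A h = D" for h
  proof -
    let ?c = "\<lambda>x. card {i \<in> I. h i = x}"
    obtain x where x: "x \<in> A" "const_dist I A h = dev I h x"
      using fin by (rule const_dist_attained)
    have cx: "?c x = card I - D" "D \<le> card I" using card_fiber_add_dev[OF fin(1), of h x] x(2) hD by auto
    have "(\<Sum>x\<in>A. ?c x) = card (\<Union>x\<in>A. {i \<in> I. h i = x})"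
      using fin by (subst card_UN_disjoint) auto
    also have "(\<Union>x\<in>A. {i \<in> I. h i = x}) = I" using h by auto
    finally have sum: "(\<Sum>x\<in>A - {x}. ?c x) = D"
      using x(1) cx fin(2) by (simp add: sum.remove)
    have "image_mset ?c (mset_set (A - {x})) = rest"
    proof (cases "card A = 2")
      case True
      then obtain y where "A - {x} = {y}"
        using x(1) fin(2) by (metis One_nat_def Suc_1 card_1_singletonE card_Diff_singleton diff_Suc_1)
      then show ?thesis using sum True by (simp add: rest_def)
    next
      case False
      then have I3: "card I = 3" using small by simp
      \<comment> \<open>The multiplicity of \<open>y\<close> is at most \<open>D\<close> and, as
        \<open>x\<close> is a nearest value, at most \<open>3 - D\<close>.\<close>
      have "?c y \<le> 1" if y: "y \<in> A - {x}" for y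
      proof -
        have "?c y \<le> D"
          using sum member_le_sum[of y "A - {x}" ?c] y fin(2) by simp
        moreover have "?c y \<le> card I - D"
          using card_fiber_add_dev[OF fin(1), of h y] const_dist_le[OF fin, of y h] y hD by auto
        ultimately show ?thesis using I3 by simp
      qed
      then have "image_mset ?c (mset_set (A - {x})) = replicate_mset D 1 + replicate_mset (card (A - {x}) - D) 0"
        using image_mset_01[of "A - {x}" ?c] fin(2) sum by simp
      then show ?thesis using False x(1) fin(2) by (simp add: rest_def)
    qed
    moreover have "mset_set A = add_mset x (mset_set (A - {x}))"
      using x(1) fin(2) by (simp add: mset_set.remove)
    ultimately show ?thesis using cx by simp
  qed
  show ?thesis using *[OF f] *[OF g] d by (simp add: D_def)
qed

section \<open>Two tuples at equal distance with different move counts\<close>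

text \<open>Counting moves to all \<open>e\<close> with \<open>2 * e < n\<close> at once gives
  different totals for the two tuples, so the counts differ for some single \<open>e\<close>.
  Prescribing the value at \<open>i0\<close> lets the tuples serve as ratio tuples, whose entry 0 is
  the identity.\<close>

lemma exists_unequal_moves:
  assumes fin: "finite I" "finite A" and I4: "4 \<le> card I" and A3: "3 \<le> card A"
    and i0: "i0 \<in> I" and x0: "x0 \<in> A"
  obtains f g e where "f \<in> I \<rightarrow> A" "g \<in> I \<rightarrow> A" "f i0 = x0" "g i0 = x0"
    "const_dist I A f = const_dist I A g"
    "card (moves_to I A f e) \<noteq> card (moves_to I A g e)"
proof -
  define n where "n = card I"
  define k where "k = n div 2"
  have A_ne: "A \<noteq> {}" using x0 by auto
  note fin' = fin A_ne
  have k: "2 \<le> k" "2 * k \<le> n" "n \<le> 2 * k + 1"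
    using I4 by (auto simp: k_def n_def)
  have "2 \<le> card (A - {x0})" using A3 x0 fin by simp
  then obtain Y where "Y \<subseteq> A - {x0}" "card Y = 2" by (rule obtain_subset_with_card_n)
  then obtain y z where yz: "y \<in> A" "z \<in> A" "y \<noteq> x0" "z \<noteq> x0" "y \<noteq> z"
    by (auto simp: card_2_iff)
  \<comment> \<open>\<open>K\<close> avoids \<open>i0\<close>, so that both tuples keep the value
    \<open>x0\<close> there.\<close>
  have "k \<le> card (I - {i0})" using k i0 fin(1) by (simp add: n_def)
  then obtain K where K: "K \<subseteq> I - {i0}" "card K = k" by (rule obtain_subset_with_card_n)
  have finK: "finite K" using K fin(1) by (meson finite_Diff finite_subset)
  obtain p where p: "p \<in> K" using K(2) k by fastforce
  have pI: "p \<in> I" "p \<noteq> i0" using p K by auto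
  define f where "f i = (if i \<in> K then y else x0)" for i
  define g where "g = f(p := z)"
  have f: "f \<in> I \<rightarrow> A" and g: "g \<in> I \<rightarrow> A" and fi0: "f i0 = x0" and gi0: "g i0 = x0"
    using yz x0 K pI by (auto simp: f_def g_def)
  have fib: "{i \<in> I. f i = x0} = I - K" "{i \<in> I. f i = y} = K"
    "\<And>w. w \<noteq> x0 \<Longrightarrow> w \<noteq> y \<Longrightarrow> {i \<in> I. f i = w} = {}"
    using yz K by (auto simp: f_def)
  have KI: "card (I - K) = n - k" using K finK by (subst card_Diff_subset) (auto simp: n_def)
  have dev_f: "dev I f x0 = k" "dev I f y = n - k"
    unfolding dev_eq_card_diff[OF fin(1)] fib KI using K(2) k by (auto simp: n_def)
  have dev_f': "dev I f w = n" if "w \<noteq> x0" "w \<noteq> y" for w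
    unfolding dev_eq_card_diff[OF fin(1)] fib(3)[OF that] by (simp add: n_def)
  have dev_g: "dev I g x0 = k" "dev I g y = Suc (n - k)" "dev I g z = n - 1"
    "\<And>w. w \<noteq> x0 \<Longrightarrow> w \<noteq> y \<Longrightarrow> w \<noteq> z \<Longrightarrow> dev I g w = n"
    subgoal using dev_upd[OF fin(1) pI(1), of f z x0] dev_f(1) yz p by (simp add: g_def f_def)
    subgoal using dev_upd[OF fin(1) pI(1), of f z y] dev_f(2) yz p by (simp add: g_def f_def)
    subgoal using dev_upd[OF fin(1) pI(1), of f z z] dev_f'[of z] yz p by (simp add: g_def f_def)
    subgoal for w using dev_upd[OF fin(1) pI(1), of f z w] dev_f'[of w] p by (simp add: g_def f_def)
    done
  have cf: "const_dist I A f = k"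
  proof (rule const_dist_eqI[OF fin' x0 dev_f(1)])
    fix w assume "w \<in> A"
    show "k \<le> dev I f w"
      using dev_f dev_f' k by (cases "w = x0"; cases "w = y") auto
  qed
  have cg: "const_dist I A g = k"
  proof (rule const_dist_eqI[OF fin' x0 dev_g(1)])
    fix w assume "w \<in> A"
    show "k \<le> dev I g w"
      using dev_g k by (cases "w = x0"; cases "w = y"; cases "w = z") auto
  qed
  \<comment> \<open>the changes of one entry after which some value has a strict majority\<close>
  define T where "T h = {(i, a) \<in> moves I A h. 2 * const_dist I A (h(i := a)) < n}" for h
  have fin_moves: "finite (moves I A h)" for h
    by (rule finite_subset[of _ "I \<times> A"]) (use fin in \<open>auto simp: moves_def\<close>)
  have T_UN: "T h = (\<Union>e\<in>{e. 2 * e < n}. moves_to I A h e)" for h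
    by (auto simp: T_def moves_to_def)
  have card_T: "card (T h) = (\<Sum>e\<in>{e. 2 * e < n}. card (moves_to I A h e))" for h
    unfolding T_UN
  proof (rule card_UN_disjoint)
    show "finite {e. 2 * e < n}" by (rule finite_subset[of _ "{..n}"]) auto
    show "\<forall>e\<in>{e. 2 * e < n}. finite (moves_to I A h e)"
      by (auto intro: finite_subset[OF _ fin_moves] simp: moves_to_def)
  qed (auto simp: moves_to_def)
  have Tg: "2 * dev I (g(i := a)) x0 < n" if ia: "(i, a) \<in> T g" for i a
  proof -
    obtain x where x: "x \<in> A" "2 * dev I (g(i := a)) x < n"
      using ia const_dist_less_iff[OF fin'] by (auto simp: T_def)
    have "x = x0"
    proof (rule ccontr)
      assume "x \<noteq> x0"
      \<comment> \<open>Here \<open>2 \<le> k\<close> is used: it makes the deviation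
        \<open>n - 1\<close> from \<open>z\<close> large enough. After one move at least
        \<open>n - k\<close> deviations remain, which is at least half of \<open>n\<close>.\<close>
      then have "Suc (n - k) \<le> dev I g x"
        using dev_g k by (cases "x = y"; cases "x = z") auto
      then have "n - k \<le> dev I (g(i := a)) x"
        using dev_upd[OF fin(1), of i g a x] ia by (auto simp: T_def moves_def of_bool_def split: if_splits)
      then show False using x(2) k by simp
    qed
    then show ?thesis using x by simp
  qed
  \<comment> \<open>For \<open>g\<close> only \<open>x0\<close> can get the majority, so exchanging \<open>y\<close> and \<open>z\<close> at \<open>p\<close> embeds \<open>T g\<close>
    into \<open>T f\<close>; it misses \<open>(i0, y)\<close>, which gives the majority to \<open>y\<close>.\<close>
  define \<phi> where "\<phi> = (\<lambda>(i, a). (i, if i = p then Transposition.transpose y z a else a))"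
  have "\<phi> ` T g \<subseteq> T f - {(i0, y)}"
  proof
    fix r assume "r \<in> \<phi> ` T g"
    then obtain i a where ia: "(i, a) \<in> T g" and r: "r = \<phi> (i, a)" by auto
    then have m: "i \<in> I" "a \<in> A" "a \<noteq> g i" by (auto simp: T_def moves_def)
    define b where "b = (if i = p then Transposition.transpose y z a else a)"
    \<comment> \<open>At \<open>p\<close> the transposition carries \<open>g p = z\<close> to
      \<open>f p = y\<close>, so a genuine change of \<open>g\<close> becomes a genuine change of
      \<open>f\<close>.\<close>
    have b: "b \<in> A" "b \<noteq> f i" "b = x0 \<longleftrightarrow> a = x0"
      using m yz p by (auto simp: b_def g_def f_def Transposition.transpose_def)
    have "f i = x0 \<longleftrightarrow> g i = x0" using p yz by (auto simp: g_def f_def)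
    then have "dev I (f(i := b)) x0 = dev I (g(i := a)) x0"
      using dev_upd[OF fin(1) m(1), of f b x0] dev_upd[OF fin(1) m(1), of g a x0] b(3) dev_f(1) dev_g(1) by simp
    then have "2 * dev I (f(i := b)) x0 < n" using Tg[OF ia] by simp
    then have "2 * const_dist I A (f(i := b)) < n"
      unfolding const_dist_less_iff[OF fin'] using x0 by blast
    then have "(i, b) \<in> T f" using m(1) b(1,2) by (simp add: T_def moves_def)
    moreover have "(i, b) \<noteq> (i0, y)"
    proof
      assume "(i, b) = (i0, y)"
      \<comment> \<open>As \<open>i0 \<noteq> p\<close>, nothing is transposed. This move would
        destroy an entry \<open>x0\<close> of \<open>g\<close> and raise the deviation from
        \<open>x0\<close> to \<open>k + 1\<close>, contrary to
        \<open>n \<le> 2 * k + 1\<close>.\<close>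
      then have "i = i0" "a = y" using pI by (auto simp: b_def)
      then show False
        using Tg[OF ia] dev_upd[OF fin(1) i0, of g y x0] dev_g(1) gi0 yz k by simp
    qed
    ultimately show "r \<in> T f - {(i0, y)}" by (simp add: r \<phi>_def b_def)
  qed
  moreover have "inj_on \<phi> (T g)"
    by (rule inj_onI) (auto simp: \<phi>_def split: if_splits dest: injD[OF inj_transpose])
  moreover have finT: "finite (T f)" by (rule finite_subset[OF _ fin_moves]) (auto simp: T_def)
  ultimately have "card (T g) \<le> card (T f - {(i0, y)})"
    by (metis card_image card_mono finite_Diff)
  moreover have "(i0, y) \<in> T f"
  proof -
    have "Suc (dev I (f(i0 := y)) y) = n - k"
      using dev_upd[OF fin(1) i0, of f y y] dev_f(2) fi0 yz by simp
    then have "2 * dev I (f(i0 := y)) y < n" using k by simp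
    then show ?thesis
      using const_dist_less_iff[OF fin', of "f(i0 := y)" n] yz i0 fi0 by (auto simp: T_def moves_def)
  qed
  ultimately have "card (T g) < card (T f)"
    using finT by (meson card_Diff1_less le_less_trans)
  then have "\<exists>e. card (moves_to I A f e) \<noteq> card (moves_to I A g e)"
    unfolding card_T by (auto intro: ccontr)
  then obtain e where "card (moves_to I A f e) \<noteq> card (moves_to I A g e)" ..
  with f g fi0 gi0 cf cg show ?thesis by (intro that) auto
qed

section \<open>A criterion for the graph distance\<close>

text \<open>Since \<open>\<delta>\<close> grows by at most one per arc, it bounds the length of
  walks from \<open>u\<close> from below; following \<open>closer\<close> back to \<open>u\<close>
  gives a walk of exactly that length.\<close>

lemma (in wf_digraph) unit_dist_eqI:
  fixes \<delta> :: "'a \<Rightarrow> nat"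
  assumes u: "u \<in> verts G"
    and zero: "\<And>v. v \<in> verts G \<Longrightarrow> \<delta> v = 0 \<longleftrightarrow> v = u"
    and step: "\<And>v w. v \<rightarrow> w \<Longrightarrow> \<delta> w \<le> Suc (\<delta> v)"
    and closer: "\<And>v. v \<in> verts G \<Longrightarrow> 0 < \<delta> v \<Longrightarrow> \<exists>w. w \<rightarrow> v \<and> Suc (\<delta> w) = \<delta> v"
    and v: "v \<in> verts G"
  shows "graph_dist G u v = ereal (real (\<delta> v))"
proof -
  have cost: "awalk_cost (\<lambda>_. 1) p = real (length p)" for p
    by (induction p) auto
  have lower: "\<delta> w \<le> \<delta> x + length p" if "awalk x p w" for x p w
    using that
  proof (induction p arbitrary: x)
    case Nil
    then show ?case by (simp add: awalk_Nil_iff)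
  next
    case (Cons e p)
    then have e: "e \<in> arcs G" "tail G e = x" and p: "awalk (head G e) p w"
      by (auto simp: awalk_Cons_iff)
    then have "x \<rightarrow> head G e" by (auto intro: in_arcs_imp_in_arcs_ends)
    from step[OF this] Cons.IH[OF p] show ?case by simp
  qed
  have upper: "\<exists>p. awalk u p w \<and> length p = d" if "w \<in> verts G" "\<delta> w = d" for w d
    using that
  proof (induction d arbitrary: w)
    case 0
    then show ?case using zero u by (auto intro!: exI[of _ "[]"] simp: awalk_Nil_iff)
  next
    case (Suc d)
    then obtain x where x: "x \<rightarrow> w" "\<delta> x = d" using closer[of w] by auto
    then have "x \<in> verts G" by (auto dest: adj_in_verts)
    with Suc.IH x obtain p where p: "awalk u p x" "length p = d" by blast
    from x(1) obtain e where "e \<in> arcs G" "tail G e = x" "head G e = w"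
      by (auto simp: arcs_ends_conv)
    then have "awalk x [e] w" using Suc.prems(1) \<open>x \<in> verts G\<close>
      by (auto simp: awalk_Cons_iff awalk_Nil_iff)
    with p have "awalk u (p @ [e]) w \<and> length (p @ [e]) = Suc d"
      by (auto intro: awalk_appendI simp del: awalk_append_iff)
    then show ?case by blast
  qed
  obtain p where p: "awalk u p v" "length p = \<delta> v" using upper[OF v refl] by blast
  have "\<mu> (\<lambda>_. 1) u v = ereal (real (\<delta> v))"
  proof (rule antisym)
    show "\<mu> (\<lambda>_. 1) u v \<le> ereal (real (\<delta> v))"
      using min_cost_le_walk_cost[OF p(1), of "\<lambda>_. 1"] p(2) by (simp add: cost)
    show "ereal (real (\<delta> v)) \<le> \<mu> (\<lambda>_. 1) u v"
      unfolding \<mu>_def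
    proof (rule INF_greatest)
      fix q assume "q \<in> {q. awalk u q v}"
      then show "ereal (real (\<delta> v)) \<le> ereal (awalk_cost (\<lambda>_. 1) q)"
        using lower[of u q v] zero[OF u] by (simp add: cost)
    qed
  qed
  then show ?thesis by (simp add: graph_dist_def)
qed

section \<open>Ratio tuples and the neighbours of a vertex\<close>

text \<open>The inverse stands on the right so that a left factor of \<open>v\<close> becomes a left
  factor of all entries \<open>i \<ge> 1\<close>. The extra entry 0 puts \<open>Q\<^sub>0\<close> on
  the same footing as the coordinate partitions.\<close>

definition ratio :: "('a, 'b) monoid_scheme \<Rightarrow> (nat \<Rightarrow> 'a) \<Rightarrow> (nat \<Rightarrow> 'a) \<Rightarrow> nat \<Rightarrow> 'a" where
  "ratio G u v i = (if i = 0 then \<one>\<^bsub>G\<^esub> else v i \<otimes>\<^bsub>G\<^esub> inv\<^bsub>G\<^esub> u i)"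

text \<open>Replacing the entry \<open>0\<close> of a ratio tuple, which is \<open>1\<close>, by \<open>a\<close> and then multiplying by
  \<open>a\<^sup>-\<^sup>1\<close> to restore the \<open>1\<close> amounts to multiplying \<open>v\<close> by \<open>a\<^sup>-\<^sup>1\<close>.\<close>

definition neighbour :: "('a, 'b) monoid_scheme \<Rightarrow> nat \<Rightarrow> (nat \<Rightarrow> 'a) \<Rightarrow> (nat \<Rightarrow> 'a) \<Rightarrow> nat \<times> 'a \<Rightarrow> nat \<Rightarrow> 'a" where
  "neighbour G m u v = (\<lambda>(i, a). if i = 0 then (\<lambda>j\<in>{1..m}. inv\<^bsub>G\<^esub> a \<otimes>\<^bsub>G\<^esub> v j) else v(i := a \<otimes>\<^bsub>G\<^esub> u i))"

locale finite_diagonal_graph = group G for G :: "('a, 'b) monoid_scheme" (structure) +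
  fixes m :: nat
  assumes finite_carrier: "finite (carrier G)" and m_ge_2: "2 \<le> m"
begin

abbreviation "X \<equiv> with_proj (diagonal_graph G m)"
abbreviation "\<Omega> \<equiv> diag_verts G m"
abbreviation "cdist \<equiv> const_dist {0..m} (carrier G)"

lemma carrier_ne: "carrier G \<noteq> {}"
  using one_closed by blast

lemmas finiteness = finite_atLeastAtMost[of 0 m] finite_carrier carrier_ne

lemma verts_closed: "v \<in> \<Omega> \<Longrightarrow> 1 \<le> j \<Longrightarrow> j \<le> m \<Longrightarrow> v j \<in> carrier G"
  unfolding diag_verts_def by auto

lemma verts_eqI: "v \<in> \<Omega> \<Longrightarrow> w \<in> \<Omega> \<Longrightarrow> (\<And>j. 1 \<le> j \<Longrightarrow> j \<le> m \<Longrightarrow> v j = w j) \<Longrightarrow> v = w"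
  unfolding diag_verts_def by (rule PiE_ext) auto

lemma verts_X: "pverts (diagonal_graph G m) = \<Omega>"
  by (simp add: diagonal_graph_def)

lemma adj_iff: "v \<rightarrow>\<^bsub>X\<^esub> w \<longleftrightarrow> v \<noteq> w \<and> (\<exists>i\<in>{0..m}. (v, w) \<in> diag_rel G m i)"
proof -
  have "v \<rightarrow>\<^bsub>X\<^esub> w \<longleftrightarrow> v \<in> \<Omega> \<and> w \<in> \<Omega> \<and> v \<noteq> w \<and> (\<exists>i\<in>{0..m}. (v, w) \<in> diag_rel G m i)"
    by (simp add: diagonal_graph_def same_part_iff[OF is_group])
  moreover have "v \<in> \<Omega> \<and> w \<in> \<Omega>" if "(v, w) \<in> diag_rel G m i" for i
    using that by (simp add: diag_rel_def)
  ultimately show ?thesis by blast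
qed

lemma ratio_closed: "u \<in> \<Omega> \<Longrightarrow> v \<in> \<Omega> \<Longrightarrow> ratio G u v \<in> {0..m} \<rightarrow> carrier G"
  by (auto simp: ratio_def verts_closed)

lemma neighbour_in_verts:
  assumes "u \<in> \<Omega>" "v \<in> \<Omega>" "i \<le> m" "a \<in> carrier G"
  shows "neighbour G m u v (i, a) \<in> \<Omega>"
proof (cases "i = 0")
  case True
  then show ?thesis using assms by (auto simp: neighbour_def diag_verts_def)
next
  case False
  then show ?thesis
    using assms verts_closed[OF assms(1)] by (auto simp: neighbour_def diag_verts_def PiE_def extensional_def)
qed

text \<open>For \<open>i = 0\<close> the two tuples differ by the common left factor
  \<open>inv a\<close>, which permutes the constant tuples; for \<open>i > 0\<close> they agree on
  all indices, and the factor is \<open>\<one>\<close>.\<close>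

lemma cdist_neighbour:
  assumes u: "u \<in> \<Omega>" and v: "v \<in> \<Omega>" and i: "i \<le> m" and a: "a \<in> carrier G"
  shows "cdist (ratio G u (neighbour G m u v (i, a))) = cdist ((ratio G u v)(i := a))"
proof -
  let ?\<pi> = "\<lambda>x. (if i = 0 then inv a else \<one>) \<otimes> x"
  have "bij_betw ?\<pi> (carrier G) (carrier G)"
    by (rule bij_betwI[of _ _ _ "\<lambda>x. (if i = 0 then a else \<one>) \<otimes> x"])
      (use a in \<open>auto simp: m_assoc[symmetric]\<close>)
  moreover have "bij_betw id {0..m} {0..m}" by simp
  moreover have "(ratio G u v)(i := a) \<in> {0..m} \<rightarrow> carrier G"
    using ratio_closed[OF u v] a by auto
  moreover have "ratio G u (neighbour G m u v (i, a)) (id j) = ?\<pi> (((ratio G u v)(i := a)) j)"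
    if "j \<in> {0..m}" for j
    using that a i u v verts_closed[OF u, of j] verts_closed[OF v, of j]
    by (auto simp: ratio_def neighbour_def m_assoc)
  ultimately show ?thesis
    by (intro const_dist_reindex[OF finiteness, where \<sigma> = id and \<pi> = ?\<pi>]) auto
qed

text \<open>Moves at entry 0 give the neighbours in \<open>Q\<^sub>0\<close>, moves at
  \<open>i > 0\<close> those in \<open>Q\<^sub>i\<close>. No neighbour is obtained twice, since
  distinct partitions share no pair of distinct vertices in a part.\<close>

lemma bij_betw_neighbour:
  assumes u: "u \<in> \<Omega>" and v: "v \<in> \<Omega>"
  shows "bij_betw (neighbour G m u v) (moves {0..m} (carrier G) (ratio G u v)) {w. v \<rightarrow>\<^bsub>X\<^esub> w}"
  unfolding bij_betw_def
proof
  let ?M = "moves {0..m} (carrier G) (ratio G u v)"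
  note uc = verts_closed[OF u] and vc = verts_closed[OF v]
  have eval_0: "neighbour G m u v (0, a) j = inv a \<otimes> v j" if "1 \<le> j" "j \<le> m" for a j
    using that by (simp add: neighbour_def)
  have eval: "neighbour G m u v (i, a) = v(i := a \<otimes> u i)" if "1 \<le> i" for i a
    using that by (simp add: neighbour_def)
  have ratio_ne: "a \<otimes> u i \<noteq> v i" if "(i, a) \<in> ?M" "1 \<le> i" for i a
  proof
    assume "a \<otimes> u i = v i"
    moreover have "i \<le> m" "a \<in> carrier G" "a \<noteq> v i \<otimes> inv u i"
      using that by (auto simp: moves_def ratio_def)
    ultimately show False using uc that(2) by (metis inv_solve_right' m_closed)
  qed
  have one_ne: "inv a \<otimes> v j \<noteq> v j" if "(0, a) \<in> ?M" "1 \<le> j" "j \<le> m" for a j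
    using that vc[of j] by (auto simp: moves_def ratio_def inv_eq_1_iff)
  show "inj_on (neighbour G m u v) ?M"
  proof (rule inj_onI)
    \<comment> \<open>As \<open>m \<ge> 2\<close>, some coordinate \<open>k\<close> differs from
      \<open>j\<close>. The coordinate move fixes it, while a nontrivial left factor changes every
      coordinate.\<close>
    have mixed: False
      if "(0, a) \<in> ?M" "(j, b) \<in> ?M" "1 \<le> j" "neighbour G m u v (0, a) = neighbour G m u v (j, b)" for a j b
    proof -
      obtain k where k: "1 \<le> k" "k \<le> m" "k \<noteq> j" using m_ge_2 by (cases "j = 1") (auto intro: that[of 1] that[of 2])
      have "neighbour G m u v (0, a) k = v k" using that(4) eval[OF that(3)] k by simp
      with one_ne[OF that(1) k(1,2)] eval_0[OF k(1,2)] show False by simp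
    qed
    fix p q assume pq: "p \<in> ?M" "q \<in> ?M" "neighbour G m u v p = neighbour G m u v q"
    obtain i a j b where p: "p = (i, a)" and q: "q = (j, b)" by (metis surj_pair)
    have ab: "a \<in> carrier G" "b \<in> carrier G" "i \<le> m" "j \<le> m"
      using pq p q by (auto simp: moves_def)
    consider "i = 0" "j = 0" | "i = 0" "1 \<le> j" | "1 \<le> i" "j = 0" | "1 \<le> i" "1 \<le> j" by linarith
    then show "p = q"
    proof cases
      case 1
      then have "inv a \<otimes> v 1 = inv b \<otimes> v 1"
        using pq(3) p q eval_0[of 1 a] eval_0[of 1 b] m_ge_2 by simp
      then have "inv a = inv b" using ab vc[of 1] m_ge_2 by simp
      then have "a = b" using ab by (metis inv_inv)
      with 1 p q show ?thesis by simp
    next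
      case 2
      then show ?thesis using mixed[of a j b] pq p q by simp
    next
      case 3
      then show ?thesis using mixed[of b i a] pq p q by simp
    next
      case 4
      then have eq: "v(i := a \<otimes> u i) = v(j := b \<otimes> u j)" using pq(3) p q eval by simp
      have "i = j"
      proof (rule ccontr)
        assume "i \<noteq> j"
        then have "a \<otimes> u i = v i" using fun_cong[OF eq, of i] by simp
        then show False using ratio_ne[of i a] pq p 4 by simp
      qed
      then have "a \<otimes> u i = b \<otimes> u i" using fun_cong[OF eq, of i] by simp
      then show ?thesis using \<open>i = j\<close> p q ab uc[of i] 4 by simp
    qed
  qed
  show "neighbour G m u v ` ?M = {w. v \<rightarrow>\<^bsub>X\<^esub> w}"
  proof (intro equalityI subsetI)
    fix w assume "w \<in> neighbour G m u v ` ?M"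
    then obtain i a where ia: "(i, a) \<in> ?M" and w: "w = neighbour G m u v (i, a)" by auto
    have i: "i \<le> m" and a: "a \<in> carrier G" using ia by (auto simp: moves_def)
    have w': "w \<in> \<Omega>" using neighbour_in_verts[OF u v i a] w by simp
    have "v \<noteq> w \<and> (v, w) \<in> diag_rel G m i"
    proof (cases "i = 0")
      case True
      have "v 1 \<noteq> w 1" using one_ne[of a 1] eval_0[of 1 a] True w ia m_ge_2 by auto
      moreover have "\<forall>j\<in>{1..m}. w j = inv a \<otimes> v j" using eval_0 True w by auto
      ultimately show ?thesis using True u v w' a by (auto simp: diag_rel_def)
    next
      case False
      have "v i \<noteq> w i" using ratio_ne[OF ia] eval[of i a] False w by auto
      then show ?thesis using eval[of i a] w w' v False by (simp add: diag_rel_def) (metis fun_upd_apply)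
    qed
    then show "w \<in> {w. v \<rightarrow>\<^bsub>X\<^esub> w}"
      unfolding mem_Collect_eq adj_iff using i by auto
  next
    fix w assume "w \<in> {w. v \<rightarrow>\<^bsub>X\<^esub> w}"
    then obtain i where ne: "v \<noteq> w" and i: "i \<le> m" and r: "(v, w) \<in> diag_rel G m i"
      unfolding mem_Collect_eq adj_iff by auto
    have w: "w \<in> \<Omega>" using r by (auto simp: diag_rel_def)
    show "w \<in> neighbour G m u v ` ?M"
    proof (cases "i = 0")
      case True
      then obtain x where x: "x \<in> carrier G" "\<And>j. 1 \<le> j \<Longrightarrow> j \<le> m \<Longrightarrow> w j = x \<otimes> v j"
        using r by (auto simp: diag_rel_def)
      have "x \<noteq> \<one>"
        using ne verts_eqI[OF v w] x(2) vc by fastforce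
      then have "inv x \<noteq> \<one>" using x(1) by (simp add: inv_eq_1_iff)
      \<comment> \<open>The inverse appears because \<open>neighbour\<close> multiplies by
        \<open>inv a\<close>.\<close>
      then have mem: "(0, inv x) \<in> ?M" using x(1) by (simp add: moves_def ratio_def)
      have "w = neighbour G m u v (0, inv x)"
        using x by (intro verts_eqI[OF w neighbour_in_verts[OF u v]]) (auto simp: eval_0)
      with mem show ?thesis by blast
    next
      case False
      have wv: "w j = v j" if "1 \<le> j" "j \<le> m" "j \<noteq> i" for j
        using r False that by (auto simp: diag_rel_def)
      have wi: "w i \<in> carrier G" "u i \<in> carrier G" "v i \<in> carrier G"
        using verts_closed[OF w, of i] uc[of i] vc[of i] False i by auto
      have "w i \<noteq> v i"
        using ne verts_eqI[OF v w] wv by metis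
      then have mem: "(i, w i \<otimes> inv u i) \<in> ?M"
        using wi i False by (auto simp: moves_def ratio_def)
      have "w = neighbour G m u v (i, w i \<otimes> inv u i)"
        using wi i False wv by (intro verts_eqI[OF w neighbour_in_verts[OF u v]]) (auto simp: eval m_assoc)
      with mem show ?thesis by blast
    qed
  qed
qed

section \<open>Distances and neighbour counts in the diagonal graph\<close>

lemma adj_sym: "v \<rightarrow>\<^bsub>X\<^esub> w \<Longrightarrow> w \<rightarrow>\<^bsub>X\<^esub> v"
  by (auto simp: diagonal_graph_def)

text \<open>The criterion \<open>unit_dist_eqI\<close> applies because neighbours of
  \<open>v\<close> correspond to changes of one entry of its ratio tuple.\<close>

lemma graph_dist_eq:
  assumes u: "u \<in> \<Omega>" and v: "v \<in> \<Omega>"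
  shows "graph_dist X u v = ereal (real (cdist (ratio G u v)))"
proof -
  interpret X: graph X by (rule graph_diagonal_graph[OF finite_carrier])
  show ?thesis
  proof (rule X.unit_dist_eqI)
    show "u \<in> verts X" "v \<in> verts X" using u v by (auto simp: verts_X)
  next
    fix v assume "v \<in> verts X"
    then have v: "v \<in> \<Omega>" by (simp add: verts_X)
    show "cdist (ratio G u v) = 0 \<longleftrightarrow> v = u"
    proof
      assume "cdist (ratio G u v) = 0"
      then obtain x where x: "\<And>i. i \<le> m \<Longrightarrow> ratio G u v i = x"
        using const_dist_eq_0_iff[OF finiteness] by auto
      \<comment> \<open>Entry 0 forces the constant to be the identity.\<close>
      have "x = \<one>" using x[of 0] by (simp add: ratio_def)
      then have "v j \<otimes> inv u j = \<one>" if "1 \<le> j" "j \<le> m" for j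
        using x[of j] that by (simp add: ratio_def)
      then have "v j = u j" if "1 \<le> j" "j \<le> m" for j
        using that verts_closed[OF u that] verts_closed[OF v that] by (metis inv_equality inv_inv inv_closed)
      then show "v = u" by (rule verts_eqI[OF v u])
    next
      assume "v = u"
      then have "\<forall>i\<in>{0..m}. ratio G u v i = \<one>" using verts_closed[OF u] by (auto simp: ratio_def)
      then show "cdist (ratio G u v) = 0" using const_dist_eq_0_iff[OF finiteness] by blast
    qed
    assume pos: "0 < cdist (ratio G u v)"
    then obtain i a where ia: "(i, a) \<in> moves {0..m} (carrier G) (ratio G u v)"
        "Suc (cdist ((ratio G u v)(i := a))) = cdist (ratio G u v)"
      by (rule const_dist_decrease[OF finiteness])
    then have "Suc (cdist (ratio G u (neighbour G m u v (i, a)))) = cdist (ratio G u v)"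
      using cdist_neighbour[OF u v, of i a] by (simp add: moves_def)
    moreover have "v \<rightarrow>\<^bsub>X\<^esub> neighbour G m u v (i, a)"
      using bij_betw_apply[OF bij_betw_neighbour[OF u v] ia(1)] by simp
    ultimately show "\<exists>w. w \<rightarrow>\<^bsub>X\<^esub> v \<and> Suc (cdist (ratio G u w)) = cdist (ratio G u v)"
      using adj_sym by blast
  next
    fix v w assume vw: "v \<rightarrow>\<^bsub>X\<^esub> w"
    then have v: "v \<in> \<Omega>" by (auto simp: diagonal_graph_def)
    have "w \<in> neighbour G m u v ` moves {0..m} (carrier G) (ratio G u v)"
      using bij_betw_imp_surj_on[OF bij_betw_neighbour[OF u v]] vw by simp
    then obtain i a where "i \<le> m" "a \<in> carrier G" "w = neighbour G m u v (i, a)"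
      by (auto simp: moves_def)
    then show "cdist (ratio G u w) \<le> Suc (cdist (ratio G u v))"
      using cdist_neighbour[OF u v, of i a] const_dist_upd_le[OF finiteness, of i "ratio G u v" a] by simp
  qed
qed

text \<open>The bijection between moves and neighbours respects the distance reached.\<close>

lemma card_neighbours_at_dist:
  assumes u: "u \<in> \<Omega>" and v: "v \<in> \<Omega>"
  shows "card {w. v \<rightarrow>\<^bsub>X\<^esub> w \<and> graph_dist X u w = ereal (real e)} =
    card (moves_to {0..m} (carrier G) (ratio G u v) e)"
proof -
  let ?M = "moves {0..m} (carrier G) (ratio G u v)"
  note bij = bij_betw_neighbour[OF u v]
  have "{w. v \<rightarrow>\<^bsub>X\<^esub> w \<and> graph_dist X u w = ereal (real e)} =
      {w \<in> neighbour G m u v ` ?M. graph_dist X u w = ereal (real e)}"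
    using bij_betw_imp_surj_on[OF bij] by auto
  also have "\<dots> = neighbour G m u v ` moves_to {0..m} (carrier G) (ratio G u v) e"
    using graph_dist_eq[OF u neighbour_in_verts[OF u v]] cdist_neighbour[OF u v]
    by (auto simp: moves_to_def moves_def image_iff)
  finally show ?thesis
    using inj_on_subset[OF bij_betw_imp_inj_on[OF bij], of "moves_to {0..m} (carrier G) (ratio G u v) e"]
    by (simp add: card_image moves_to_def subset_iff)
qed

text \<open>All distances are finite by \<open>graph_dist_eq\<close>, whereas an unreachable vertex
  would have distance infinity.\<close>

lemma connected_X: "Digraph_Component.connected X"
proof -
  interpret X: graph X by (rule graph_diagonal_graph[OF finite_carrier])
  have "u \<rightarrow>\<^sup>*\<^bsub>X\<^esub> v" if "u \<in> \<Omega>" "v \<in> \<Omega>" for u v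
    using X.shortest_path_inf[of u v "\<lambda>_. 1"] graph_dist_eq[OF that] by (auto simp: graph_dist_def)
  moreover have "(\<lambda>j\<in>{1..m}. \<one>) \<in> \<Omega>" by (auto simp: diag_verts_def)
  ultimately show ?thesis
    unfolding connected_def
    by (intro strongly_connectedI X.reachable_mk_symmetricI) (auto simp: verts_X)
qed

section \<open>Distance-regularity as a condition on tuples\<close>

text \<open>The graph is eliminated here. Every pair of vertices is represented by its ratio tuple,
  and every tuple with entry 0 equal to \<open>\<one>\<close> is the ratio tuple of a pair whose
  first vertex is constantly \<open>\<one>\<close>.\<close>

lemma distance_regular_iff:
  "distance_regular X \<longleftrightarrow>
    (\<forall>f g e. f \<in> {0..m} \<rightarrow> carrier G \<longrightarrow> g \<in> {0..m} \<rightarrow> carrier G \<longrightarrow> f 0 = \<one> \<longrightarrow> g 0 = \<one> \<longrightarrow>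
       cdist f = cdist g \<longrightarrow>
       card (moves_to {0..m} (carrier G) f e) = card (moves_to {0..m} (carrier G) g e))"
  (is "_ \<longleftrightarrow> ?R")
proof
  assume dr: "distance_regular X"
  show ?R
  proof (intro allI impI)
    fix f g e
    assume f: "f \<in> {0..m} \<rightarrow> carrier G" "f 0 = \<one>" and g: "g \<in> {0..m} \<rightarrow> carrier G" "g 0 = \<one>"
      and d: "cdist f = cdist g"
    let ?u = "\<lambda>j\<in>{1..m}. \<one>"
    define d where "d = cdist f"
    have u: "?u \<in> \<Omega>" by (auto simp: diag_verts_def)
    obtain c a b where N: "\<And>v. v \<in> \<Omega> \<Longrightarrow> graph_dist X ?u v = ereal (real d) \<Longrightarrow>
       card {w. v \<rightarrow>\<^bsub>X\<^esub> w \<and> graph_dist X ?u w = ereal (real d - 1)} = c \<and>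
       card {w. v \<rightarrow>\<^bsub>X\<^esub> w \<and> graph_dist X ?u w = ereal (real d)} = a \<and>
       card {w. v \<rightarrow>\<^bsub>X\<^esub> w \<and> graph_dist X ?u w = ereal (real d + 1)} = b"
      using dr u unfolding distance_regular_def with_proj_simps verts_X by meson
    have *: "card (moves_to {0..m} (carrier G) h e) =
        (if Suc e = d then c else if e = d then a else if e = Suc d then b else 0)"
      if h: "h \<in> {0..m} \<rightarrow> carrier G" "h 0 = \<one>" and hd: "cdist h = d" for h
    proof -
      let ?v = "restrict h {1..m}"
      have v: "?v \<in> \<Omega>" using h(1) by (auto simp: diag_verts_def)
      have rat: "ratio G ?u ?v i = h i" if "i \<in> {0..m}" for i
        using that h by (auto simp: ratio_def Pi_iff)
      have id: "bij_betw id {0..m} {0..m}" "bij_betw id (carrier G) (carrier G)" by auto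
      have "cdist (ratio G ?u ?v) = d"
        using const_dist_reindex[OF finiteness id h(1), of "ratio G ?u ?v"] rat hd by simp
      then have dist: "graph_dist X ?u ?v = ereal (real d)" using graph_dist_eq[OF u v] by simp
      have eq: "card (moves_to {0..m} (carrier G) h e) =
          card {w. ?v \<rightarrow>\<^bsub>X\<^esub> w \<and> graph_dist X ?u w = ereal (real e)}"
        using card_moves_to_reindex[OF finiteness id h(1), of "ratio G ?u ?v"] rat
        unfolding card_neighbours_at_dist[OF u v] by simp
      show ?thesis
      proof (cases "Suc e = d \<or> e = d \<or> e = Suc d")
        case True
        then consider "real e = real d - 1" "Suc e = d" | "e = d" | "real e = real d + 1" "e = Suc d"
          by fastforce
        then show ?thesis using N[OF v dist] unfolding eq by cases (auto simp: add.commute)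
      next
        case False
        \<comment> \<open>The definition of distance-regularity is silent about these
          \<open>e\<close>, but one move changes the distance by at most one.\<close>
        have "moves_to {0..m} (carrier G) h e = {}"
        proof (rule ccontr)
          assume "\<not> ?thesis"
          then obtain i x where "i \<in> {0..m}" "cdist (h(i := x)) = e" by (auto simp: moves_to_def moves_def)
          then show False
            using False hd const_dist_upd_le[OF finiteness, of i h x] const_dist_le_upd[OF finiteness, of i h x] by simp
        qed
        then show ?thesis using False by simp
      qed
    qed
    show "card (moves_to {0..m} (carrier G) f e) = card (moves_to {0..m} (carrier G) g e)"
      using *[OF f] *[OF g] d by (simp add: d_def)
  qed
next
  assume R: ?R
  \<comment> \<open>The number \<open>r\<close> is real in order to cover \<open>real d - 1\<close>,
    which is -1 for \<open>d = 0\<close>; no vertex lies at a distance that is not a natural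
    number.\<close>
  have *: "card {w. v \<rightarrow>\<^bsub>X\<^esub> w \<and> graph_dist X u w = ereal r} = card {w. v' \<rightarrow>\<^bsub>X\<^esub> w \<and> graph_dist X u' w = ereal r}"
    if uv: "u \<in> \<Omega>" "v \<in> \<Omega>" "u' \<in> \<Omega>" "v' \<in> \<Omega>" and d: "graph_dist X u v = graph_dist X u' v'" for u v u' v' r
  proof (cases "\<exists>e. r = real e")
    case True
    then obtain e where r: "r = real e" ..
    have "cdist (ratio G u v) = cdist (ratio G u' v')"
      using d by (simp add: graph_dist_eq uv)
    then show ?thesis
      unfolding r card_neighbours_at_dist[OF uv(1,2)] card_neighbours_at_dist[OF uv(3,4)]
      by (intro R[rule_format] ratio_closed uv) (simp_all add: ratio_def)
  next
    case False
    have "{w. v \<rightarrow>\<^bsub>X\<^esub> w \<and> graph_dist X u w = ereal r} = {}" if "u \<in> \<Omega>" for u v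
      using False graph_dist_eq[OF that] by (auto simp: diagonal_graph_def)
    then show ?thesis using uv by (simp only: card.empty)
  qed
  have "\<exists>c a b. \<forall>u\<in>\<Omega>. \<forall>v\<in>\<Omega>. graph_dist X u v = ereal (real d) \<longrightarrow>
       card {w. v \<rightarrow>\<^bsub>X\<^esub> w \<and> graph_dist X u w = ereal (real d - 1)} = c \<and>
       card {w. v \<rightarrow>\<^bsub>X\<^esub> w \<and> graph_dist X u w = ereal (real d)} = a \<and>
       card {w. v \<rightarrow>\<^bsub>X\<^esub> w \<and> graph_dist X u w = ereal (real d + 1)} = b" for d
  proof (cases "\<exists>u\<in>\<Omega>. \<exists>v\<in>\<Omega>. graph_dist X u v = ereal (real d)")
    case True
    then obtain u v where uv: "u \<in> \<Omega>" "v \<in> \<Omega>" "graph_dist X u v = ereal (real d)" by blast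
    \<comment> \<open>The counts at the chosen pair serve as \<open>c\<close>, \<open>a\<close> and
      \<open>b\<close>.\<close>
    show ?thesis
      by (intro exI ballI impI conjI; rule *[OF _ _ uv(1,2)]) (simp_all only: uv(3))
  next
    case False
    then show ?thesis by simp
  qed
  then show "distance_regular X"
    unfolding distance_regular_def with_proj_simps verts_X
    using graph_diagonal_graph[OF finite_carrier] connected_X by blast
qed

end

theorem proposition7p3:
  fixes G :: "('a, 'b) monoid_scheme" and m :: nat
  assumes "m \<ge> 2"
    and "group G" and "finite (carrier G)" and "card (carrier G) \<ge> 2"
  shows "distance_regular (with_proj (diagonal_graph G m)) \<longleftrightarrow> m = 2 \<or> card (carrier G) = 2"
proof -
  interpret group G by fact
  interpret finite_diagonal_graph G m
    by unfold_locales (use assms in auto)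
  show ?thesis
  proof
    assume dr: "distance_regular X"
    show "m = 2 \<or> card (carrier G) = 2"
    proof (rule ccontr)
      assume "\<not> ?thesis"
      \<comment> \<open>The index set has \<open>m + 1\<close> elements, so \<open>m \<ge> 3\<close>
        gives at least four positions.\<close>
      then have "4 \<le> card {0..m}" "3 \<le> card (carrier G)" using assms by auto
      from exists_unequal_moves[OF finite_atLeastAtMost finite_carrier this, of 0 "\<one>\<^bsub>G\<^esub>"]
      obtain f g e where "f \<in> {0..m} \<rightarrow> carrier G" "g \<in> {0..m} \<rightarrow> carrier G"
        "f 0 = \<one>\<^bsub>G\<^esub>" "g 0 = \<one>\<^bsub>G\<^esub>"
        "cdist f = cdist g"
        "card (moves_to {0..m} (carrier G) f e) \<noteq> card (moves_to {0..m} (carrier G) g e)"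
        by auto
      then show False using dr unfolding distance_regular_iff by blast
    qed
  next
    assume "m = 2 \<or> card (carrier G) = 2"
    then have small: "card (carrier G) = 2 \<or> card {0..m} = 3" by auto
    show "distance_regular X"
      unfolding distance_regular_iff
    proof (intro allI impI)
      fix f g e
      assume f: "f \<in> {0..m} \<rightarrow> carrier G" and g: "g \<in> {0..m} \<rightarrow> carrier G" and d: "cdist f = cdist g"
      show "card (moves_to {0..m} (carrier G) f e) = card (moves_to {0..m} (carrier G) g e)"
        by (rule card_moves_to_eq_if_fiber_sizes[OF finiteness g f fiber_sizes_cong[OF finiteness g f d[symmetric] small]])
    qed
  qed
qed

end
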